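(* Let $G$ be a graph of treewidth at most $w$ and $R\subseteq V(G)$ with $|R|\ge 2$. Then every Non-pendant $R$-CIST of $G$ has size at most $w+1$.
   Context: Graphs are finite and connected, may have parallel edges but no loops; treewidth is the usual treewidth (of the underlying simple graph). For a tree $T$, $\mathrm{int}(T)$ is the set of vertices of degree at least 2 and $L(T)$ the set of leaves. An $R$-Steiner tree is a subtree $T$ with $R\subseteq V(T)$ and $L(T)\subseteq R$; it is non-pendant if $\mathrm{int}(T)\cap R\ne\emptyset$. $T(u,v)$ is the unique $(u,v)$-path in $T$. An $R$-CIST of size $k$ is a set $\{T_1,\dots,T_k\}$ of $R$-Steiner trees such that for all distinct $u,v\in R$ and distinct $i,j$, $T_i(u,v)$ and $T_j(u,v)$ are edge-disjoint and internally vertex-disjoint; it is a Non-pendant $R$-CIST if all its trees are non-pendant. *)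

theory Defs
  imports Main
begin

text \<open>Undirected multigraphs without loops: \<open>ends e\<close> is the two-element set of end vertices
  of the edge \<open>e\<close>, so parallel edges are distinct elements of \<open>edges\<close> with the same \<open>ends\<close>.\<close>

record ('v, 'e) mgraph =
  verts :: "'v set"
  edges :: "'e set"
  ends :: "'e \<Rightarrow> 'v set"

definition multigraph :: "('v, 'e) mgraph \<Rightarrow> bool" where
  "multigraph G \<longleftrightarrow> finite (verts G) \<and> finite (edges G) \<and>
     (\<forall>e\<in>edges G. ends G e \<subseteq> verts G \<and> card (ends G e) = 2)"

definition adjacent :: "('v, 'e) mgraph \<Rightarrow> 'v \<Rightarrow> 'v \<Rightarrow> bool" where
  "adjacent G u v \<longleftrightarrow> (\<exists>e\<in>edges G. ends G e = {u, v})"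

definition degree :: "('v, 'e) mgraph \<Rightarrow> 'v \<Rightarrow> nat" where
  "degree G v = card {e \<in> edges G. v \<in> ends G e}"

text \<open>The walk \<open>u e\<^sub>1 x\<^sub>1 e\<^sub>2 x\<^sub>2 \<dots> e\<^sub>n x\<^sub>n\<close> is represented by its first vertex \<open>u\<close> and
  the list \<open>[(e\<^sub>1, x\<^sub>1), \<dots>, (e\<^sub>n, x\<^sub>n)]\<close>.\<close>

fun walk :: "('v, 'e) mgraph \<Rightarrow> 'v \<Rightarrow> ('e \<times> 'v) list \<Rightarrow> 'v \<Rightarrow> bool" where
  "walk G u [] v \<longleftrightarrow> u \<in> verts G \<and> u = v"
| "walk G u ((e, x) # p) v \<longleftrightarrow>
     u \<in> verts G \<and> e \<in> edges G \<and> ends G e = {u, x} \<and> walk G x p v"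

definition path :: "('v, 'e) mgraph \<Rightarrow> 'v \<Rightarrow> ('e \<times> 'v) list \<Rightarrow> 'v \<Rightarrow> bool" where
  "path G u p v \<longleftrightarrow> walk G u p v \<and> distinct (u # map snd p)"

text \<open>Two parallel edges form a cycle of length 2; distinctness of the edges excludes
  traversing a single edge back and forth.\<close>

definition cycle :: "('v, 'e) mgraph \<Rightarrow> 'v \<Rightarrow> ('e \<times> 'v) list \<Rightarrow> bool" where
  "cycle G u p \<longleftrightarrow> walk G u p u \<and> p \<noteq> [] \<and> distinct (map fst p) \<and> distinct (map snd p)"

definition connected_graph :: "('v, 'e) mgraph \<Rightarrow> bool" where
  "connected_graph G \<longleftrightarrow>
     verts G \<noteq> {} \<and> (\<forall>u\<in>verts G. \<forall>v\<in>verts G. \<exists>p. walk G u p v)"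

definition tree :: "('v, 'e) mgraph \<Rightarrow> bool" where
  "tree T \<longleftrightarrow> multigraph T \<and> connected_graph T \<and> \<not> (\<exists>u p. cycle T u p)"

text \<open>Requiring the functions \<open>ends\<close> to agree everywhere (and not just on the edges of \<open>H\<close>)
  makes a subgraph determined by its vertices and edges.\<close>

definition subgraph :: "('v, 'e) mgraph \<Rightarrow> ('v, 'e) mgraph \<Rightarrow> bool" where
  "subgraph H G \<longleftrightarrow> multigraph H \<and> verts H \<subseteq> verts G \<and> edges H \<subseteq> edges G \<and> ends H = ends G"

definition induced :: "('v, 'e) mgraph \<Rightarrow> 'v set \<Rightarrow> ('v, 'e) mgraph" where
  "induced G S =
     \<lparr>verts = verts G \<inter> S, edges = {e \<in> edges G. ends G e \<subseteq> S}, ends = ends G\<rparr>"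


text \<open>Every finite tree is isomorphic to one with natural numbers as nodes and edges, so it
  suffices to use these as decomposition trees. Only adjacency in \<open>G\<close> matters, so the notions
  below are those of the underlying simple graph of \<open>G\<close>.\<close>

definition tree_decomposition ::
  "('v, 'e) mgraph \<Rightarrow> (nat, nat) mgraph \<Rightarrow> (nat \<Rightarrow> 'v set) \<Rightarrow> bool" where
  "tree_decomposition G T B \<longleftrightarrow> tree T \<and>
     (\<Union>t\<in>verts T. B t) = verts G \<and>
     (\<forall>u v. adjacent G u v \<longrightarrow> (\<exists>t\<in>verts T. u \<in> B t \<and> v \<in> B t)) \<and>
     (\<forall>v\<in>verts G. connected_graph (induced T {t \<in> verts T. v \<in> B t}))"

definition width :: "(nat, nat) mgraph \<Rightarrow> (nat \<Rightarrow> 'v set) \<Rightarrow> nat" where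
  "width T B = Max ((\<lambda>t. card (B t)) ` verts T) - 1"

definition treewidth :: "('v, 'e) mgraph \<Rightarrow> nat" where
  "treewidth G = (LEAST k. \<exists>T B. tree_decomposition G T B \<and> width T B = k)"


definition int_verts :: "('v, 'e) mgraph \<Rightarrow> 'v set" where
  "int_verts T = {v \<in> verts T. degree T v \<ge> 2}"

definition leaves :: "('v, 'e) mgraph \<Rightarrow> 'v set" where
  "leaves T = {v \<in> verts T. degree T v = 1}"

definition tree_path :: "('v, 'e) mgraph \<Rightarrow> 'v \<Rightarrow> 'v \<Rightarrow> ('e \<times> 'v) list" where
  "tree_path T u v = (THE p. path T u p v)"

definition path_edges :: "('e \<times> 'v) list \<Rightarrow> 'e set" where
  "path_edges p = fst ` set p"

text \<open>The first vertex of a path is not stored in the list, and its last vertex is stored in the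
  last entry.\<close>

definition inner_verts :: "('e \<times> 'v) list \<Rightarrow> 'v set" where
  "inner_verts p = snd ` set (butlast p)"

definition steiner_tree :: "('v, 'e) mgraph \<Rightarrow> 'v set \<Rightarrow> ('v, 'e) mgraph \<Rightarrow> bool" where
  "steiner_tree G R T \<longleftrightarrow> subgraph T G \<and> tree T \<and> R \<subseteq> verts T \<and> leaves T \<subseteq> R"

definition non_pendant :: "'v set \<Rightarrow> ('v, 'e) mgraph \<Rightarrow> bool" where
  "non_pendant R T \<longleftrightarrow> int_verts T \<inter> R \<noteq> {}"

definition CIST :: "('v, 'e) mgraph \<Rightarrow> 'v set \<Rightarrow> ('v, 'e) mgraph set \<Rightarrow> bool" where
  "CIST G R \<T> \<longleftrightarrow> finite \<T> \<and> (\<forall>T\<in>\<T>. steiner_tree G R T) \<and>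
     (\<forall>u\<in>R. \<forall>v\<in>R. \<forall>T\<in>\<T>. \<forall>T'\<in>\<T>. u \<noteq> v \<longrightarrow> T \<noteq> T' \<longrightarrow>
        path_edges (tree_path T u v) \<inter> path_edges (tree_path T' u v) = {} \<and>
        inner_verts (tree_path T u v) \<inter> inner_verts (tree_path T' u v) = {})"

definition non_pendant_CIST :: "('v, 'e) mgraph \<Rightarrow> 'v set \<Rightarrow> ('v, 'e) mgraph set \<Rightarrow> bool" where
  "non_pendant_CIST G R \<T> \<longleftrightarrow> CIST G R \<T> \<and> (\<forall>T\<in>\<T>. non_pendant R T)"

end

theory Submission
  imports Defs
begin

text \<open>No vertex \<open>v\<close> is internal in two of the trees: it would split \<open>R - {v}\<close> into at least
  two classes in each of them, and since a set is never the union of two non-trivial equivalence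
  relations, some two vertices of \<open>R\<close> would be separated by \<open>v\<close> in both trees. So the sets
  \<open>int(T\<^sub>i)\<close> are pairwise disjoint. Each is connected, and a vertex of \<open>R\<close> internal in
  \<open>T\<^sub>i\<close> is a leaf of \<open>T\<^sub>j\<close> whose neighbour is internal in \<open>T\<^sub>j\<close>. Hence these sets are the
  branch sets of a complete minor, and by the Helly property of subtrees
  some bag of any tree decomposition meets all of them.\<close>

section \<open>Walks inside a vertex set\<close>

text \<open>Confining walks to \<open>S\<close> replaces vertex deletion:
  \<open>reach T (- {v})\<close> is the relation of lying in the same component of \<open>T\<close>
  minus \<open>v\<close>.\<close>

definition reach :: "('v, 'e) mgraph \<Rightarrow> 'v set \<Rightarrow> 'v \<Rightarrow> 'v \<Rightarrow> bool" where
  "reach G S u v \<longleftrightarrow> (\<exists>p. walk G u p v \<and> insert u (snd ` set p) \<subseteq> S)"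

lemma walk_verts:
  assumes "walk G u p v"
  shows "insert u (snd ` set p) \<subseteq> verts G" "v \<in> insert u (snd ` set p)"
  using assms by (induction G u p v rule: walk.induct) auto

lemma walk_last: "walk G u p v \<Longrightarrow> p \<noteq> [] \<Longrightarrow> snd (last p) = v"
  by (induction G u p v rule: walk.induct) (auto split: if_splits)

lemma walk_append: "walk G u p v \<Longrightarrow> walk G v q w \<Longrightarrow> walk G u (p @ q) w"
  by (induction G u p v rule: walk.induct) auto

lemma walk_snocE:
  assumes "walk G u (p @ [(e, x)]) v"
  obtains y where "walk G u p y" "e \<in> edges G" "ends G e = {y, x}" "x = v"
proof -
  have "\<exists>y. walk G u p y \<and> e \<in> edges G \<and> ends G e = {y, x} \<and> x = v"
    using assms by (induction p arbitrary: u) auto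
  then show ?thesis using that by blast
qed

lemma walk_edge_ends: "walk G u p v \<Longrightarrow> e \<in> fst ` set p \<Longrightarrow> ends G e \<subseteq> insert u (snd ` set p)"
  by (induction G u p v rule: walk.induct) auto

lemma reach_mem:
  assumes "reach G S u v"
  shows "u \<in> S" "v \<in> S" "u \<in> verts G" "v \<in> verts G"
proof -
  obtain p where "walk G u p v" "insert u (snd ` set p) \<subseteq> S"
    using assms unfolding reach_def by blast
  then show "u \<in> S" "v \<in> S" "u \<in> verts G" "v \<in> verts G"
    using walk_verts[of G u p v] by auto
qed

lemma reach_refl: "u \<in> verts G \<Longrightarrow> u \<in> S \<Longrightarrow> reach G S u u"
  unfolding reach_def by (rule exI[of _ "[]"]) auto

lemma reach_trans:
  assumes "reach G S u v" "reach G S v w"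
  shows "reach G S u w"
proof -
  obtain p q where "walk G u p v" "insert u (snd ` set p) \<subseteq> S"
    "walk G v q w" "insert v (snd ` set q) \<subseteq> S"
    using assms unfolding reach_def by blast
  then have "walk G u (p @ q) w \<and> insert u (snd ` set (p @ q)) \<subseteq> S"
    using walk_append by auto
  then show ?thesis unfolding reach_def by blast
qed

lemma reach_mono: "reach G S u v \<Longrightarrow> S \<subseteq> S' \<Longrightarrow> reach G S' u v"
  unfolding reach_def by blast

lemma reach_step:
  assumes "e \<in> edges G" "ends G e = {u, x}" "u \<in> verts G" "u \<in> S" "reach G S x v"
  shows "reach G S u v"
proof -
  obtain p where "walk G x p v" "insert x (snd ` set p) \<subseteq> S"
    using assms unfolding reach_def by blast
  then have "walk G u ((e, x) # p) v \<and> insert u (snd ` set ((e, x) # p)) \<subseteq> S"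
    using assms by auto
  then show ?thesis unfolding reach_def by blast
qed

lemma reach_induct [consumes 1, case_names refl step]:
  assumes "reach G S u v"
    and "v \<in> verts G \<Longrightarrow> v \<in> S \<Longrightarrow> P v"
    and "\<And>e u x. e \<in> edges G \<Longrightarrow> ends G e = {u, x} \<Longrightarrow> u \<in> verts G \<Longrightarrow> u \<in> S \<Longrightarrow>
      reach G S x v \<Longrightarrow> P x \<Longrightarrow> P u"
  shows "P u"
proof -
  obtain p where "walk G u p v" "insert u (snd ` set p) \<subseteq> S"
    using assms(1) unfolding reach_def by blast
  then show ?thesis
  proof (induction p arbitrary: u)
    case Nil
    then show ?case using assms(2) by auto
  next
    case (Cons a p)
    obtain e x where a: "a = (e, x)" by (cases a)
    have w: "walk G x p v" and s: "insert x (snd ` set p) \<subseteq> S" using Cons.prems a by auto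
    have "reach G S x v" unfolding reach_def using w s by blast
    then show ?case using Cons.prems a Cons.IH[OF w s] assms(3)[of e u x] by auto
  qed
qed

lemma reach_sym: "reach G S u v \<Longrightarrow> reach G S v u"
proof (induction rule: reach_induct)
  case refl
  then show ?case by (rule reach_refl)
next
  case (step e u x)
  have "reach G S x u"
    using reach_step[OF step(1), of x u] step reach_refl[of u G S] reach_mem[OF step(5)]
    by (simp add: insert_commute)
  then show ?case using step reach_trans by metis
qed

lemma walk_reach_vertex:
  "walk G u p v \<Longrightarrow> y \<in> insert u (snd ` set p) \<Longrightarrow> reach G (insert u (snd ` set p)) u y"
proof (induction p arbitrary: u)
  case Nil
  then show ?case by (auto intro: reach_refl)
next
  case (Cons a p)
  obtain e x where a: "a = (e, x)" by (cases a)
  show ?case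
  proof (cases "y = u")
    case True
    then show ?thesis using Cons.prems a by (auto intro: reach_refl)
  next
    case False
    then have "reach G (insert x (snd ` set p)) x y" using Cons a by auto
    then have "reach G (insert u (snd ` set (a # p))) x y"
      by (rule reach_mono) (auto simp: a)
    then show ?thesis using Cons.prems a by (auto intro: reach_step[of e])
  qed
qed

section \<open>Paths extracted from walks\<close>

lemma path_Cons:
  "path G u ((e, x) # p) v \<longleftrightarrow> u \<in> verts G \<and> e \<in> edges G \<and> ends G e = {u, x} \<and>
     path G x p v \<and> u \<notin> insert x (snd ` set p)"
  by (auto simp: path_def)

lemma path_suffix:
  "path G x p v \<Longrightarrow> u \<in> insert x (snd ` set p) \<Longrightarrow>
     \<exists>q. path G u q v \<and> snd ` set q \<subseteq> snd ` set p"
proof (induction p arbitrary: x)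
  case Nil
  then show ?case by auto
next
  case (Cons a p)
  obtain e y where a: "a = (e, y)" by (cases a)
  show ?case
  proof (cases "u = x")
    case True
    then show ?thesis using Cons.prems by blast
  next
    case False
    then show ?thesis using Cons.prems Cons.IH[of y] a by (auto simp: path_Cons)
  qed
qed

text \<open>Prepending an edge to a path gives a path unless the new vertex already lies on it; in
  that case the suffix starting at that vertex serves instead.\<close>

lemma reach_path: "reach G S u v \<Longrightarrow> \<exists>p. path G u p v \<and> insert u (snd ` set p) \<subseteq> S"
proof (induction rule: reach_induct)
  case refl
  then show ?case by (intro exI[of _ "[]"]) (auto simp: path_def)
next
  case (step e u x)
  then obtain p where p: "path G x p v" "insert x (snd ` set p) \<subseteq> S" by blast
  show ?case
  proof (cases "u \<in> insert x (snd ` set p)")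
    case True
    obtain q where "path G u q v" "snd ` set q \<subseteq> snd ` set p"
      using path_suffix[OF p(1) True] by blast
    then show ?thesis using p(2) step(4) by (intro exI[of _ q]) auto
  next
    case False
    then have "path G u ((e, x) # p) v" using p(1) step(1-3) by (auto simp: path_Cons)
    then show ?thesis using p(2) step(4) by (intro exI[of _ "(e, x) # p"]) auto
  qed
qed

lemma path_reach: "path G u p v \<Longrightarrow> insert u (snd ` set p) \<subseteq> S \<Longrightarrow> reach G S u v"
  unfolding reach_def path_def by blast

text \<open>If the first edge occurred again, its end \<open>u\<close> would be among the later
  vertices.\<close>

lemma path_distinct_edges: "path G u p v \<Longrightarrow> distinct (map fst p)"
proof (induction p arbitrary: u)
  case (Cons a p)
  obtain e x where a: "a = (e, x)" by (cases a)
  have "e \<notin> fst ` set p"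
    using Cons.prems walk_edge_ends[of G x p v e] by (auto simp: a path_Cons path_def)
  then show ?case using Cons a by (auto simp: path_Cons)
qed auto

section \<open>Trees\<close>

lemma tree_reach: "tree T \<Longrightarrow> u \<in> verts T \<Longrightarrow> v \<in> verts T \<Longrightarrow> reach T (verts T) u v"
  using walk_verts(1)[of T u _ v] unfolding tree_def connected_graph_def reach_def by blast

text \<open>A path from \<open>x\<close> to \<open>y\<close> avoiding \<open>u\<close> closes up to
  a cycle through \<open>e\<close> and \<open>f\<close>. Thus different edges at \<open>u\<close>
  lead to different components of \<open>T\<close> minus \<open>u\<close>; later arguments use
  acyclicity in this form. The case \<open>x = y\<close> excludes parallel edges.\<close>

lemma tree_cut:
  assumes "tree T" "e \<in> edges T" "f \<in> edges T" "e \<noteq> f" "ends T e = {u, x}" "ends T f = {u, y}"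
  shows "\<not> reach T (- {u}) x y"
proof
  assume r: "reach T (- {u}) x y"
  obtain p where p: "path T x p y" "insert x (snd ` set p) \<subseteq> - {u}"
    using reach_path[OF r] by blast
  have u: "u \<in> verts T" using assms unfolding tree_def multigraph_def by blast
  have "walk T y [(f, u)] u" using assms u reach_mem[OF r] by auto
  then have "walk T x (p @ [(f, u)]) u" using p walk_append unfolding path_def by metis
  then have w: "walk T u ((e, x) # p @ [(f, u)]) u" using assms u by auto
  \<comment> \<open>Both ends of an edge of \<open>p\<close> lie on \<open>p\<close>, which misses
    \<open>u\<close>; so neither \<open>e\<close> nor \<open>f\<close> occurs in
    \<open>p\<close>.\<close>
  have n: "g \<notin> fst ` set p" if "u \<in> ends T g" for g
    using walk_edge_ends[of T x p y g] p that unfolding path_def by blast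
  have "distinct (map fst ((e, x) # p @ [(f, u)]))"
    using path_distinct_edges[OF p(1)] n[of e] n[of f] assms by auto
  moreover have "distinct (map snd ((e, x) # p @ [(f, u)]))"
    using p unfolding path_def by auto
  ultimately have "cycle T u ((e, x) # p @ [(f, u)])" using w unfolding cycle_def by blast
  then show False using assms(1) unfolding tree_def by blast
qed

text \<open>The remainders of both paths avoid \<open>u\<close> and meet in \<open>v\<close>, so by
  \<open>tree_cut\<close> their first edges coincide; induction does the rest.\<close>

lemma tree_path_unique: "tree T \<Longrightarrow> path T u p v \<Longrightarrow> path T u q v \<Longrightarrow> p = q"
proof (induction p arbitrary: u q)
  case Nil
  then show ?case
  proof (cases q)
    case (Cons a q')
    then show ?thesis using Nil walk_verts(2)[of T "snd a" q' v]
      by (cases a) (auto simp: path_def)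
  qed auto
next
  case (Cons a p)
  obtain e x where a: "a = (e, x)" by (cases a)
  have p: "path T x p v" "u \<notin> insert x (snd ` set p)" using Cons.prems a by (auto simp: path_Cons)
  show ?case
  proof (cases q)
    case Nil
    then show ?thesis using Cons.prems p walk_verts(2)[of T x p v] by (auto simp: path_def)
  next
    case (Cons b q')
    obtain f y where b: "b = (f, y)" by (cases b)
    have q: "path T y q' v" "u \<notin> insert y (snd ` set q')"
      using Cons.prems Cons b by (auto simp: path_Cons)
    have ef: "e \<in> edges T" "f \<in> edges T" "ends T e = {u, x}" "ends T f = {u, y}"
      using Cons.prems Cons a b by (auto simp: path_Cons)
    have "reach T (- {u}) x v" "reach T (- {u}) y v"
      using p q path_reach by (metis subset_Compl_singleton)+
    then have "e = f" using tree_cut[of T e f u x y] ef Cons.prems(1) reach_sym reach_trans by metis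
    then have "x = y" using ef by (auto simp: doubleton_eq_iff)
    then have "p = q'" using Cons.IH[OF Cons.prems(1) p(1)] q by blast
    then show ?thesis using a b Cons \<open>e = f\<close> \<open>x = y\<close> by simp
  qed
qed

lemma path_tree_path:
  assumes "tree T" "u \<in> verts T" "v \<in> verts T"
  shows "path T u (tree_path T u v) v"
proof -
  obtain p where "path T u p v" using reach_path[OF tree_reach[OF assms]] by blast
  then show ?thesis unfolding tree_path_def
    using tree_path_unique[OF assms(1)] by (metis theI)
qed

text \<open>A tree path missing \<open>x\<close> would witness \<open>reach T (- {x}) u v\<close>.
  This turns separation by a vertex into the inner vertices that \<open>CIST\<close> speaks
  of.\<close>

lemma cut_vertex_in_tree_path:
  assumes "tree T" "u \<in> verts T" "v \<in> verts T" "u \<noteq> x" "v \<noteq> x" "\<not> reach T (- {x}) u v"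
  shows "x \<in> inner_verts (tree_path T u v)"
proof -
  let ?p = "tree_path T u v"
  have p: "path T u ?p v" by (rule path_tree_path[OF assms(1-3)])
  then have x: "x \<in> snd ` set ?p" using assms path_reach[OF p, of "- {x}"] by auto
  then obtain q b where q: "?p = q @ [b]" by (cases ?p rule: rev_cases) auto
  have "snd b = v" using p walk_last[of T u ?p v] q by (simp add: path_def)
  then show ?thesis unfolding inner_verts_def using x q assms(5) by auto
qed

section \<open>Internal vertices and leaves\<close>

lemma two_le_degree_iff:
  assumes "finite (edges G)"
  shows "degree G v \<ge> 2 \<longleftrightarrow> (\<exists>e\<in>edges G. \<exists>f\<in>edges G. e \<noteq> f \<and> v \<in> ends G e \<and> v \<in> ends G f)"
proof -
  have "degree G v \<ge> 2 \<longleftrightarrow> \<not> card {e \<in> edges G. v \<in> ends G e} \<le> Suc 0"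
    unfolding degree_def by auto
  also have "\<dots> \<longleftrightarrow> (\<exists>e\<in>edges G. \<exists>f\<in>edges G. e \<noteq> f \<and> v \<in> ends G e \<and> v \<in> ends G f)"
    using assms by (subst card_le_Suc0_iff_eq) auto
  finally show ?thesis .
qed

lemma edge_other_end:
  assumes "multigraph G" "e \<in> edges G" "v \<in> ends G e"
  obtains x where "ends G e = {v, x}" "x \<noteq> v" "x \<in> verts G"
proof -
  have "card (ends G e) = 2" "ends G e \<subseteq> verts G" using assms unfolding multigraph_def by auto
  then show ?thesis using that assms(3) by (fastforce simp: card_2_iff insert_commute)
qed

text \<open>A vertex strictly between the ends lies on two different edges of the path. The start
  \<open>u\<close> is left free, so that it may be a leaf.\<close>

lemma path_into_int_verts:
  assumes "multigraph T" "path T u p v" "v \<in> int_verts T"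
  shows "snd ` set p \<subseteq> int_verts T"
  using assms(2)
proof (induction p arbitrary: u)
  case (Cons a p)
  obtain e x where a: "a = (e, x)" by (cases a)
  have p: "path T x p v" using Cons.prems a by (simp add: path_Cons)
  have "x \<in> int_verts T"
  proof (cases p)
    case Nil
    then show ?thesis using p assms(3) by (simp add: path_def)
  next
    case (Cons b p')
    obtain f y where b: "b = (f, y)" by (cases b)
    have "e \<in> edges T" "f \<in> edges T" "x \<in> ends T e" "x \<in> ends T f" "e \<noteq> f" "x \<in> verts T"
      using Cons.prems a b Cons by (auto simp: path_Cons)
    then show ?thesis using assms(1) two_le_degree_iff[of T x]
      unfolding int_verts_def multigraph_def by blast
  qed
  then show ?case using Cons.IH[OF p] a by simp
qed auto

text \<open>A longest path that enters \<open>v\<close> through \<open>e\<close> starts at a leaf,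
  and without its last edge it stays within one component of \<open>T\<close> minus
  \<open>v\<close>.\<close>

lemma leaf_behind_edge:
  assumes "tree T" "e \<in> edges T" "v \<in> ends T e"
  obtains x a where "x \<in> leaves T" "ends T e = {v, a}" "reach T (- {v}) a x"
proof -
  have m: "multigraph T" using assms(1) unfolding tree_def by blast
  \<comment> \<open>The paths run towards \<open>v\<close>, so that lengthening one at its far end
    is a \<open>Cons\<close>. The one-edge path from \<open>a\<close> shows that they exist, and the
    number of vertices bounds their length.\<close>
  define P where "P = (\<lambda>(x, p). path T x p v \<and> p \<noteq> [] \<and> fst (last p) = e)"
  obtain a where a: "ends T e = {v, a}" "a \<noteq> v" "a \<in> verts T"
    using edge_other_end[OF m assms(2,3)] by blast
  have "v \<in> verts T" using a assms m unfolding multigraph_def by blast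
  then have "P (a, [(e, v)])" unfolding P_def using a assms(2) by (auto simp: path_def)
  moreover have "\<forall>z. P z \<longrightarrow> length (snd z) < Suc (card (verts T))"
  proof (clarify, unfold P_def, clarify)
    fix x p assume "path T x p v"
    then have "distinct (map snd p)" "set (map snd p) \<subseteq> verts T"
      using walk_verts(1)[of T x p v] unfolding path_def by auto
    then have "length (map snd p) \<le> card (verts T)"
      using m unfolding multigraph_def by (metis card_mono distinct_card)
    then show "length (snd (x, p)) < Suc (card (verts T))" by simp
  qed
  ultimately obtain z where z: "P z" "\<And>z'. P z' \<Longrightarrow> length (snd z') \<le> length (snd z)"
    using ex_has_greatest_nat[of P _ "\<lambda>z. length (snd z)" "Suc (card (verts T))"] by blast
  obtain x p where xp: "z = (x, p)" by (cases z)
  have p: "path T x p v" "p \<noteq> []" "fst (last p) = e" using z xp unfolding P_def by auto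
  obtain g y q where q: "p = (g, y) # q" using p(2) by (cases p) auto
  have g: "g \<in> edges T" "ends T g = {x, y}" "path T y q v" "x \<notin> insert y (snd ` set q)" "x \<in> verts T"
    using p(1) q by (auto simp: path_Cons)
  have "\<not> degree T x \<ge> 2"
  proof
    assume "degree T x \<ge> 2"
    then obtain f where f: "f \<in> edges T" "x \<in> ends T f" "f \<noteq> g"
      using two_le_degree_iff[of T x] m unfolding multigraph_def by metis
    obtain y' where y': "ends T f = {x, y'}" "y' \<noteq> x" "y' \<in> verts T"
      using edge_other_end[OF m f(1,2)] by blast
    \<comment> \<open>If the second edge \<open>f\<close> at \<open>x\<close> led back to the path,
      \<open>y\<close> and \<open>y'\<close> would be joined avoiding \<open>x\<close>, against
      \<open>tree_cut\<close>. Otherwise \<open>f\<close> lengthens the longest path.\<close>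
    have "y' \<notin> insert y (snd ` set q)"
    proof
      assume "y' \<in> insert y (snd ` set q)"
      then have "reach T (insert y (snd ` set q)) y y'"
        using g walk_reach_vertex unfolding path_def by metis
      then have "reach T (- {x}) y y'" by (rule reach_mono) (use g in auto)
      then show False using tree_cut[OF assms(1) g(1) f(1)] f g y' by blast
    qed
    then have "P (y', (f, x) # p)"
      unfolding P_def using p y' f q by (auto simp: path_Cons insert_commute)
    then show False using z(2)[of "(y', (f, x) # p)"] xp by auto
  qed
  moreover have "degree T x \<noteq> 0"
    using g m unfolding degree_def multigraph_def by auto
  ultimately have "x \<in> leaves T" using g unfolding leaves_def by auto
  moreover have "reach T (- {v}) a x"
  proof -
    \<comment> \<open>Dropping the final edge \<open>e\<close> leaves a walk from \<open>x\<close>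
      to the other end \<open>a\<close> of \<open>e\<close>; it misses \<open>v\<close>, which
      occurs on \<open>p\<close> only at the end.\<close>
    define p0 where "p0 = butlast p"
    have l: "p = p0 @ [(e, snd (last p))]" using p unfolding p0_def by (metis append_butlast_last_id prod.collapse)
    have lv: "snd (last p) = v" using p walk_last unfolding path_def by metis
    have "walk T x (p0 @ [(e, v)]) v" using p(1) l lv unfolding path_def by simp
    then obtain b where b: "walk T x p0 b" "ends T e = {b, v}" by (rule walk_snocE)
    have "b = a" using a b by (auto simp: doubleton_eq_iff)
    have "distinct (x # map snd (p0 @ [(e, v)]))" using p(1) l lv unfolding path_def by simp
    then have "insert x (snd ` set p0) \<subseteq> - {v}" by auto
    then have "reach T (- {v}) x b" using b unfolding reach_def by blast
    then show ?thesis using \<open>b = a\<close> reach_sym by metis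
  qed
  ultimately show ?thesis using a that by blast
qed

text \<open>Two edges at \<open>v\<close> lead to different components, and each of these contains a
  leaf. For a Steiner tree the leaves lie in \<open>R\<close>, so \<open>v\<close> separates two
  elements of \<open>R\<close>.\<close>

lemma int_vert_separates_leaves:
  assumes "tree T" "v \<in> int_verts T"
  obtains x y where "x \<in> leaves T" "y \<in> leaves T" "x \<noteq> v" "y \<noteq> v" "\<not> reach T (- {v}) x y"
proof -
  have "degree T v \<ge> 2" "finite (edges T)"
    using assms unfolding int_verts_def tree_def multigraph_def by auto
  then obtain e f where ef: "e \<in> edges T" "f \<in> edges T" "e \<noteq> f" "v \<in> ends T e" "v \<in> ends T f"
    using two_le_degree_iff[of T v] by blast
  obtain x a where x: "x \<in> leaves T" "ends T e = {v, a}" "reach T (- {v}) a x"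
    by (rule leaf_behind_edge[OF assms(1) ef(1,4)])
  obtain y b where y: "y \<in> leaves T" "ends T f = {v, b}" "reach T (- {v}) b y"
    by (rule leaf_behind_edge[OF assms(1) ef(2,5)])
  have "\<not> reach T (- {v}) a b" using tree_cut ef x y assms(1) by metis
  then have "\<not> reach T (- {v}) x y" using x y reach_sym reach_trans by metis
  then show ?thesis using that x y reach_mem(2)[OF x(3)] reach_mem(2)[OF y(3)] by blast
qed

section \<open>Disjointness of the interiors\<close>

lemma CIST_int_verts_disjoint:
  assumes "CIST G R \<T>" "T \<in> \<T>" "T' \<in> \<T>" "T \<noteq> T'"
  shows "int_verts T \<inter> int_verts T' = {}"
proof (rule ccontr)
  assume "int_verts T \<inter> int_verts T' \<noteq> {}"
  then obtain v where v: "v \<in> int_verts T" "v \<in> int_verts T'" by blast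
  have "\<forall>T\<in>\<T>. steiner_tree G R T" using assms(1) unfolding CIST_def by (elim conjE)
  then have T: "tree T" "R \<subseteq> verts T" "leaves T \<subseteq> R"
    and T': "tree T'" "R \<subseteq> verts T'" "leaves T' \<subseteq> R"
    using assms(2,3) unfolding steiner_tree_def by blast+
  let ?E = "reach T (- {v})" and ?E' = "reach T' (- {v})"
  \<comment> \<open>Two terminals separated by \<open>v\<close> in both trees have \<open>v\<close>
    as a common inner vertex of their tree paths, which \<open>CIST\<close> forbids.\<close>
  have both: False if "z \<in> R - {v}" "w \<in> R - {v}" "\<not> ?E z w" "\<not> ?E' z w" for z w
  proof -
    have "z \<noteq> w" using that T reach_refl[of z T "- {v}"] by auto
    moreover have "v \<in> inner_verts (tree_path T z w)" "v \<in> inner_verts (tree_path T' z w)"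
      using that T T' by (auto intro!: cut_vertex_in_tree_path)
    moreover have "inner_verts (tree_path T z w) \<inter> inner_verts (tree_path T' z w) = {}"
      if "z \<noteq> w" using assms that \<open>z \<in> R - {v}\<close> \<open>w \<in> R - {v}\<close> unfolding CIST_def by simp
    ultimately show False by blast
  qed
  obtain x y where l: "x \<in> leaves T" "y \<in> leaves T" "x \<noteq> v" "y \<noteq> v"
    and "\<not> ?E x y"
    by (rule int_vert_separates_leaves[OF T(1) v(1)])
  then have xy: "x \<in> R - {v}" "y \<in> R - {v}" "\<not> ?E x y" using T(3) by auto
  obtain x' y' where l': "x' \<in> leaves T'" "y' \<in> leaves T'" "x' \<noteq> v" "y' \<noteq> v"
    and "\<not> ?E' x' y'"
    by (rule int_vert_separates_leaves[OF T'(1) v(2)])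
  then have xy': "x' \<in> R - {v}" "y' \<in> R - {v}" "\<not> ?E' x' y'" using T'(3) by auto
  \<comment> \<open>By \<open>both\<close>, any two elements of \<open>R - {v}\<close> are related
    by \<open>?E\<close> or \<open>?E'\<close>. As \<open>?E'\<close> is not total, some
    \<open>z\<close> is outside the \<open>?E'\<close>-class of \<open>x\<close> and
    \<open>y\<close>; hence \<open>?E\<close> relates \<open>z\<close> to both, and so
    \<open>x\<close> to \<open>y\<close>.\<close>
  have "?E' x y" using both xy by blast
  obtain z where z: "z \<in> R - {v}" "\<not> ?E' x z" using xy' reach_sym reach_trans by metis
  then have "\<not> ?E' y z" using \<open>?E' x y\<close> reach_trans by metis
  then have "?E x z" "?E y z" using both z xy by blast+
  then show False using xy reach_sym reach_trans by metis
qed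

section \<open>Subtrees and tree decompositions\<close>

text \<open>The empty set counts as connected, unlike in \<open>connected_graph\<close>, so subtrees
  can be intersected without a proviso.\<close>

definition conn_in :: "('v, 'e) mgraph \<Rightarrow> 'v set \<Rightarrow> bool" where
  "conn_in G S \<longleftrightarrow> (\<forall>u\<in>S. \<forall>v\<in>S. reach G S u v)"

text \<open>The path inside \<open>A\<close> and the path inside \<open>B\<close> are the same path
  of the tree.\<close>

lemma conn_in_Int:
  assumes "tree T" "conn_in T A" "conn_in T B"
  shows "conn_in T (A \<inter> B)"
  unfolding conn_in_def
proof (intro ballI)
  fix u v assume uv: "u \<in> A \<inter> B" "v \<in> A \<inter> B"
  obtain p where p: "path T u p v" "insert u (snd ` set p) \<subseteq> A"
    using reach_path[of T A u v] assms uv unfolding conn_in_def by blast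
  obtain q where q: "path T u q v" "insert u (snd ` set q) \<subseteq> B"
    using reach_path[of T B u v] assms uv unfolding conn_in_def by blast
  have "p = q" using tree_path_unique[OF assms(1) p(1) q(1)] .
  then show "reach T (A \<inter> B) u v" using p q by (intro path_reach[OF p(1)]) auto
qed

text \<open>Take the last edge on which the walk leaves \<open>A\<close>: from then on it stays
  outside. The induction needs the alternative of a walk that avoids \<open>A\<close>
  altogether.\<close>

lemma reach_exit:
  assumes "reach G S a b" "a \<in> A" "b \<notin> A"
  obtains e m n where "e \<in> edges G" "ends G e = {m, n}" "m \<in> A" "m \<in> S" "n \<notin> A" "reach G (- A) n b"
proof -
  have "reach G (- A) a b \<or> (\<exists>e m n. e \<in> edges G \<and> ends G e = {m, n} \<and> m \<in> A \<and> m \<in> S \<and>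
      n \<notin> A \<and> reach G (- A) n b)"
    using assms(1)
  proof (induction rule: reach_induct)
    case refl
    then show ?case using assms by (auto intro: reach_refl)
  next
    case (step e u x)
    show ?case
    proof (cases "reach G (- A) x b")
      case True
      show ?thesis
      proof (cases "u \<in> A")
        case True
        moreover have "x \<notin> A" using reach_mem(1)[OF \<open>reach G (- A) x b\<close>] by simp
        ultimately show ?thesis using step(1,2,4) \<open>reach G (- A) x b\<close> by blast
      next
        case False
        then have "reach G (- A) u b"
          using reach_step[OF step(1-3) _ \<open>reach G (- A) x b\<close>] by simp
        then show ?thesis ..
      qed
    next
      case False
      then show ?thesis using step.IH by blast
    qed
  qed
  then show ?thesis using assms(2) reach_mem(1)[of G "- A" a b] that by blast
qed

text \<open>Without a common vertex, the last exit \<open>m\<close> from \<open>A\<close> on the way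
  from \<open>x\<close> to \<open>y\<close> in \<open>B\<close> lies outside \<open>C\<close>. Its
  exit edge and the first edge of the path from \<open>m\<close> to \<open>z\<close> in
  \<open>A\<close> then lead to the same component of \<open>T\<close> minus \<open>m\<close>,
  joined through \<open>C\<close>.\<close>

lemma subtrees_helly3:
  assumes T: "tree T" and c: "conn_in T A" "conn_in T B" "conn_in T C"
    and ne: "A \<inter> B \<noteq> {}" "B \<inter> C \<noteq> {}" "A \<inter> C \<noteq> {}"
  shows "A \<inter> B \<inter> C \<noteq> {}"
proof
  assume no: "A \<inter> B \<inter> C = {}"
  obtain x y z where xyz: "x \<in> A" "x \<in> B" "y \<in> B" "y \<in> C" "z \<in> A" "z \<in> C" using ne by blast
  have "reach T B x y" using c xyz unfolding conn_in_def by blast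
  moreover have "y \<notin> A" using no xyz by blast
  ultimately obtain e m n where e: "e \<in> edges T" "ends T e = {m, n}" "m \<in> A" "m \<in> B" "n \<notin> A"
    "reach T (- A) n y"
    by (rule reach_exit[OF _ xyz(1)])
  have "m \<notin> C" using no e by blast
  then have yz: "reach T (- {m}) y z"
    using c xyz reach_mono[of T C y z "- {m}"] unfolding conn_in_def by blast
  have ny: "reach T (- {m}) n y" by (rule reach_mono[OF e(6)]) (use e in auto)
  obtain p where p: "path T m p z" "insert m (snd ` set p) \<subseteq> A"
    using c e xyz reach_path[of T A m z] unfolding conn_in_def by blast
  have "m \<noteq> z" using \<open>m \<notin> C\<close> xyz by blast
  then obtain f k q where q: "p = (f, k) # q" using p by (cases p) (auto simp: path_def)
  have f: "f \<in> edges T" "ends T f = {m, k}" "k \<in> A" "path T k q z" "insert k (snd ` set q) \<subseteq> - {m}"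
    using p q by (auto simp: path_Cons)
  have "reach T (- {m}) k z" using f path_reach by metis
  then have "reach T (- {m}) n k" using yz ny reach_sym reach_trans by metis
  \<comment> \<open>The far end of \<open>f\<close> is in \<open>A\<close>, that of \<open>e\<close>
    is not.\<close>
  moreover have "e \<noteq> f" using e f by (auto simp: doubleton_eq_iff)
  ultimately show False using tree_cut[OF T e(1) f(1)] e f by blast
qed

text \<open>Intersect every subtree with \<open>S j\<close>: the results are connected by
  \<open>conn_in_Int\<close> and meet pairwise by \<open>subtrees_helly3\<close>. Taking
  \<open>i = j\<close> in the last assumption makes each subtree nonempty.\<close>

lemma subtrees_helly:
  assumes "finite I" "I \<noteq> {}" "tree T" "\<And>i. i \<in> I \<Longrightarrow> conn_in T (S i)"
    and "\<And>i j. i \<in> I \<Longrightarrow> j \<in> I \<Longrightarrow> S i \<inter> S j \<noteq> {}"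
  shows "(\<Inter>i\<in>I. S i) \<noteq> {}"
  using assms
proof (induction I arbitrary: S rule: finite_ne_induct)
  case (singleton i)
  then show ?case by auto
next
  case (insert j I)
  have "(\<Inter>i\<in>I. S i \<inter> S j) \<noteq> {}"
  proof (rule insert.IH)
    show "conn_in T (S i \<inter> S j)" if "i \<in> I" for i
      using insert.prems that by (auto intro: conn_in_Int)
    show "(S i \<inter> S j) \<inter> (S i' \<inter> S j) \<noteq> {}" if "i \<in> I" "i' \<in> I" for i i'
      using subtrees_helly3[of T "S i" "S i'" "S j"] insert.prems that
      by (simp add: Int_ac)
  qed (use insert in auto)
  then show ?case using insert.hyps by auto
qed

section \<open>Tree decompositions and complete minors\<close>

lemma conn_in_bags:
  assumes td: "tree_decomposition G T B" and X: "X \<subseteq> verts G" "conn_in G X"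
  shows "conn_in T {t \<in> verts T. B t \<inter> X \<noteq> {}}"
proof -
  let ?S = "{t \<in> verts T. B t \<inter> X \<noteq> {}}"
  have bag: "reach T ?S s t"
    if "v \<in> X" "s \<in> verts T" "t \<in> verts T" "v \<in> B s" "v \<in> B t" for v s t
  proof -
    let ?N = "{t \<in> verts T. v \<in> B t}"
    have "connected_graph (induced T ?N)" using td X that unfolding tree_decomposition_def by blast
    moreover have "s \<in> verts (induced T ?N)" "t \<in> verts (induced T ?N)"
      using that by (auto simp: induced_def)
    ultimately obtain p where p: "walk (induced T ?N) s p t"
      unfolding connected_graph_def by blast
    have "walk H s p t \<Longrightarrow> H = induced T ?N \<Longrightarrow> walk T s p t" for H
      by (induction H s p t rule: walk.induct) (auto simp: induced_def)
    then have "walk T s p t" using p by blast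
    moreover have "insert s (snd ` set p) \<subseteq> ?S"
      using walk_verts(1)[OF p] that by (auto simp: induced_def)
    ultimately show ?thesis unfolding reach_def by blast
  qed
  \<comment> \<open>Along a walk in \<open>X\<close>, consecutive vertices share a bag, which links
    their connected sets of nodes. The claim ranges over all \<open>s\<close> and \<open>t\<close>
    because the induction passes through such a shared bag \<open>r\<close>.\<close>
  have "reach G X u v \<Longrightarrow> \<forall>s t. s \<in> verts T \<longrightarrow> t \<in> verts T \<longrightarrow> u \<in> B s \<longrightarrow> v \<in> B t \<longrightarrow> reach T ?S s t"
    for u v
  proof (induction rule: reach_induct)
    case refl
    then show ?case using bag by blast
  next
    case (step e u x)
    have "adjacent G u x" using step unfolding adjacent_def by blast
    then obtain r where r: "r \<in> verts T" "u \<in> B r" "x \<in> B r"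
      using td unfolding tree_decomposition_def by blast
    show ?case
    proof (intro allI impI)
      fix s t assume st: "s \<in> verts T" "t \<in> verts T" "u \<in> B s" "v \<in> B t"
      have "reach T ?S s r" using bag[OF step(4) st(1) r(1) st(3) r(2)] .
      moreover have "reach T ?S r t" using step.IH r st by blast
      ultimately show "reach T ?S s t" by (rule reach_trans)
    qed
  qed
  then show ?thesis using X(2) unfolding conn_in_def by blast
qed

lemma clique_minor_width:
  assumes G: "finite (verts G)" and td: "tree_decomposition G T B" and I: "finite I"
    and X: "\<And>i. i \<in> I \<Longrightarrow> X i \<noteq> {} \<and> X i \<subseteq> verts G \<and> conn_in G (X i)"
    and disj: "\<And>i j. i \<in> I \<Longrightarrow> j \<in> I \<Longrightarrow> i \<noteq> j \<Longrightarrow> X i \<inter> X j = {}"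
    and adj: "\<And>i j. i \<in> I \<Longrightarrow> j \<in> I \<Longrightarrow> i \<noteq> j \<Longrightarrow> \<exists>u\<in>X i. \<exists>v\<in>X j. adjacent G u v"
  shows "card I \<le> width T B + 1"
proof (cases "I = {}")
  case False
  have T: "tree T" and cover: "(\<Union>t\<in>verts T. B t) = verts G"
    using td unfolding tree_decomposition_def by auto
  let ?S = "\<lambda>i. {t \<in> verts T. B t \<inter> X i \<noteq> {}}"
  have "?S i \<inter> ?S j \<noteq> {}" if "i \<in> I" "j \<in> I" for i j
  proof (cases "i = j")
    case True
    obtain v where v: "v \<in> X i" "v \<in> verts G" using X \<open>i \<in> I\<close> by blast
    then obtain t where "t \<in> verts T" "v \<in> B t" using cover by blast
    then show ?thesis using True v by blast
  next
    case False
    then obtain u v where uv: "u \<in> X i" "v \<in> X j" "adjacent G u v"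
      using adj[OF \<open>i \<in> I\<close> \<open>j \<in> I\<close>] by blast
    then obtain t where "t \<in> verts T" "u \<in> B t" "v \<in> B t"
      using td unfolding tree_decomposition_def by blast
    then show ?thesis using uv by blast
  qed
  moreover have "conn_in T (?S i)" if "i \<in> I" for i
    using conn_in_bags[OF td] X that by blast
  ultimately have "(\<Inter>i\<in>I. ?S i) \<noteq> {}" using subtrees_helly[OF I False T, of ?S] by blast
  then obtain t where t: "\<And>i. i \<in> I \<Longrightarrow> t \<in> verts T \<and> B t \<inter> X i \<noteq> {}" by blast
  have tT: "t \<in> verts T" using t False by blast
  have "\<forall>i\<in>I. \<exists>x. x \<in> B t \<inter> X i" using t by blast
  then obtain r where r: "\<And>i. i \<in> I \<Longrightarrow> r i \<in> B t \<inter> X i" by (metis bchoice)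
  \<comment> \<open>\<open>r\<close> picks a vertex of the common bag from each branch set;
    disjointness of the branch sets makes it injective.\<close>
  have "inj_on r I" using r disj by (intro inj_onI) (metis IntD2 IntI empty_iff)
  moreover have "finite (B t)" using tT cover G by (metis UN_upper finite_subset)
  ultimately have "card I \<le> card (B t)" using r by (intro card_inj_on_le[of r]) auto
  moreover have "card (B t) \<le> Max ((\<lambda>t. card (B t)) ` verts T)"
    using T tT unfolding tree_def multigraph_def by auto
  \<comment> \<open>The subtraction in \<open>width\<close> is truncated, but a maximum is at most
    its predecessor plus 1 even when it is 0.\<close>
  ultimately show ?thesis unfolding width_def by linarith
qed auto

text \<open>One node with the bag \<open>verts G\<close> suffices. Existence ensures that the
  \<open>LEAST\<close> in \<open>treewidth\<close> is attained.\<close>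

lemma tree_decomposition_exists:
  assumes "multigraph G"
  shows "\<exists>T B. tree_decomposition G T B"
proof -
  define T :: "(nat, nat) mgraph" where "T = \<lparr>verts = {0}, edges = {}, ends = (\<lambda>_. {})\<rparr>"
  have noedge: "walk T u p v \<Longrightarrow> p = []" for u p v
    by (cases p) (auto simp: T_def)
  have walk0: "\<exists>p. walk H 0 p 0" if "0 \<in> verts H" for H :: "(nat, nat) mgraph"
    using that by (intro exI[of _ "[]"]) auto
  have "tree T" unfolding tree_def cycle_def multigraph_def connected_graph_def
    using noedge walk0[of T] by (auto simp: T_def)
  moreover have "adjacent G u v \<Longrightarrow> u \<in> verts G \<and> v \<in> verts G" for u v
    using assms unfolding adjacent_def multigraph_def by blast
  moreover have "connected_graph (induced T {t \<in> verts T. v \<in> verts G})" if "v \<in> verts G" for v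
    using that walk0[of "induced T {0}"]
    by (auto simp: connected_graph_def induced_def T_def)
  ultimately have "tree_decomposition G T (\<lambda>_. verts G)"
    unfolding tree_decomposition_def by (auto simp: T_def)
  then show ?thesis by blast
qed

lemma clique_minor_treewidth:
  assumes "multigraph G" "finite I"
    and "\<And>i. i \<in> I \<Longrightarrow> X i \<noteq> {} \<and> X i \<subseteq> verts G \<and> conn_in G (X i)"
    and "\<And>i j. i \<in> I \<Longrightarrow> j \<in> I \<Longrightarrow> i \<noteq> j \<Longrightarrow> X i \<inter> X j = {}"
    and "\<And>i j. i \<in> I \<Longrightarrow> j \<in> I \<Longrightarrow> i \<noteq> j \<Longrightarrow> \<exists>u\<in>X i. \<exists>v\<in>X j. adjacent G u v"
  shows "card I \<le> treewidth G + 1"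
proof -
  have "\<exists>k T B. tree_decomposition G T B \<and> width T B = k"
    using tree_decomposition_exists[OF assms(1)] by blast
  then have "\<exists>T B. tree_decomposition G T B \<and> width T B = treewidth G"
    unfolding treewidth_def by (rule LeastI_ex)
  then obtain T B where TB: "tree_decomposition G T B" "width T B = treewidth G" by blast
  have "finite (verts G)" using assms(1) unfolding multigraph_def by blast
  then show ?thesis using clique_minor_width[OF _ TB(1) assms(2-5)] TB(2) by simp
qed

section \<open>The branch sets\<close>

lemma walk_subgraph: "walk H u p v \<Longrightarrow> subgraph H G \<Longrightarrow> walk G u p v"
  by (induction H u p v rule: walk.induct) (auto simp: subgraph_def)

text \<open>The tree path between two internal vertices has only internal vertices.\<close>

lemma conn_in_int_verts:
  assumes "tree T" "subgraph T G"
  shows "conn_in G (int_verts T)"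
  unfolding conn_in_def
proof (intro ballI)
  fix u v assume uv: "u \<in> int_verts T" "v \<in> int_verts T"
  let ?p = "tree_path T u v"
  have p: "path T u ?p v"
    using uv assms(1) by (intro path_tree_path) (auto simp: int_verts_def)
  then have "insert u (snd ` set ?p) \<subseteq> int_verts T"
    using path_into_int_verts[OF _ p uv(2)] uv(1) assms(1) unfolding tree_def by blast
  moreover have "walk G u ?p v" using p walk_subgraph assms(2) unfolding path_def by metis
  ultimately show "reach G (int_verts T) u v" unfolding reach_def by blast
qed

text \<open>On the tree path from \<open>u\<close> to any internal vertex, the vertex after
  \<open>u\<close> is already internal.\<close>

lemma adjacent_int_vert:
  assumes "tree T" "subgraph T G" "u \<in> verts T" "u \<notin> int_verts T" "int_verts T \<noteq> {}"
  shows "\<exists>v\<in>int_verts T. adjacent G u v"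
proof -
  obtain v where v: "v \<in> int_verts T" using assms by blast
  let ?p = "tree_path T u v"
  have p: "path T u ?p v"
    using v assms by (intro path_tree_path) (auto simp: int_verts_def)
  have s: "snd ` set ?p \<subseteq> int_verts T"
    using path_into_int_verts[OF _ p v] assms(1) unfolding tree_def by blast
  have "?p \<noteq> []" using p v assms(4) by (auto simp: path_def)
  then obtain e x q where q: "?p = (e, x) # q" by (cases ?p) auto
  have "x \<in> int_verts T" using s q by simp
  moreover have "adjacent G u x"
    using p q assms(2) unfolding adjacent_def subgraph_def by (auto simp: path_Cons)
  ultimately show ?thesis by blast
qed

theorem theorem3p21:
  fixes G :: "('v, 'e) mgraph" and R :: "'v set" and \<T> :: "('v, 'e) mgraph set" and w :: nat
  assumes "multigraph G" and "connected_graph G"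
    and "treewidth G \<le> w"
    and "R \<subseteq> verts G" and "card R \<ge> 2"
    and "non_pendant_CIST G R \<T>"
  shows "card \<T> \<le> w + 1"
proof -
  have C: "CIST G R \<T>" and np: "\<And>T. T \<in> \<T> \<Longrightarrow> int_verts T \<inter> R \<noteq> {}"
    using assms(6) unfolding non_pendant_CIST_def non_pendant_def by blast+
  have "\<forall>T\<in>\<T>. steiner_tree G R T" using C unfolding CIST_def by (elim conjE)
  then have st: "tree T" "subgraph T G" "R \<subseteq> verts T" if "T \<in> \<T>" for T
    using that unfolding steiner_tree_def by blast+
  note disj = CIST_int_verts_disjoint[OF C]
  have "card \<T> \<le> treewidth G + 1"
  proof (rule clique_minor_treewidth[where X = int_verts])
    show "finite \<T>" using C unfolding CIST_def by (elim conjE)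
    show "int_verts T \<noteq> {} \<and> int_verts T \<subseteq> verts G \<and> conn_in G (int_verts T)" if "T \<in> \<T>" for T
    proof -
      have "int_verts T \<subseteq> verts G"
        using st(2)[OF that] unfolding int_verts_def subgraph_def by auto
      then show ?thesis using np[OF that] conn_in_int_verts[OF st(1,2)[OF that]] by blast
    qed
    show "\<exists>u\<in>int_verts T. \<exists>v\<in>int_verts T'. adjacent G u v"
      if "T \<in> \<T>" "T' \<in> \<T>" "T \<noteq> T'" for T T'
    proof -
      \<comment> \<open>Non-pendancy supplies the link: \<open>r\<close> is a terminal, hence a
        vertex of \<open>T'\<close>, and by disjointness not internal there, so it has a neighbour
        in \<open>int_verts T'\<close>.\<close>
      obtain r where r: "r \<in> int_verts T" "r \<in> R" using np[OF \<open>T \<in> \<T>\<close>] by blast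
      then have "r \<notin> int_verts T'" "r \<in> verts T'" using disj that st(3) by blast+
      then show ?thesis using adjacent_int_vert[OF st(1,2)] r np that by blast
    qed
  qed (use assms(1) disj in auto)
  then show ?thesis using assms(3) by simp
qed

end
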